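(* If $G$ is a finite group, then the category $\mathbf{FI}_G$ is quasi-Gröbner.
   Context: A $G$-map $R \to S$ between finite sets is a pair $(f,\rho)$ of functions $f\colon R \to S$ and $\rho\colon R \to G$. The composition of $(f,\rho)\colon R\to S$ followed by $(g,\sigma)\colon S\to T$ is $(g\circ f,\tau)$ with $\tau(x)=\sigma(f(x))\rho(x)$. The category $\mathbf{FI}_G$ has finite sets as objects and as morphisms the $G$-maps $(f,\rho)$ with $f$ injective. Property (F): a functor $\Phi\colon\mathcal{C}'\to\mathcal{C}$ satisfies property (F) if for every object $x$ of $\mathcal{C}$ there exist finitely many objects $y_1,\dots,y_n$ of $\mathcal{C}'$ and morphisms $f_i\colon x\to\Phi(y_i)$ in $\mathcal{C}$ such that for any object $y$ of $\mathcal{C}'$ and any morphism $f\colon x\to\Phi(y)$ there exist an $i$ and a morphism $g\colon y_i\to y$ in $\mathcal{C}'$ with $f=\Phi(g)\circ f_i$. Gröbner and quasi-Gröbner: let $\mathcal{C}$ be an essentially small category. For an object $x$ let $S_x\colon\mathcal{C}\to\mathbf{Set}$, $S_x(y)=\mathrm{Hom}(x,y)$. An ordering on $S_x$ is a choice of well-order on each $S_x(y)$ such that for every morphism $y\to z$ the induced map $S_x(y)\to S_x(z)$ is strictly order-preserving; $S_x$ is orderable if it admits an ordering. On $\coprod_y S_x(y)$, for $f\in S_x(y)$ and $g\in S_x(z)$ define $f\le g$ if there is $h\colon y\to z$ with $g=h\circ f$; $|S_x|$ is the poset obtained by identifying $f,g$ whenever $f\le g$ and $g\le f$. A poset is noetherian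 if for every infinite sequence $x_1,x_2,\dots$ there exist $i<j$ with $x_i\le x_j$. $\mathcal{C}$ is Gröbner if for every object $x$, $S_x$ is orderable and $|S_x|$ is noetherian. $\mathcal{C}$ is quasi-Gröbner if there exist a Gröbner category $\mathcal{C}'$ and an essentially surjective functor $\mathcal{C}'\to\mathcal{C}$ satisfying property (F). *)

theory Defs
  imports "HOL-Algebra.Group" "HOL-Library.FuncSet" "HOL-Library.Infinite_Typeclass"
begin

(* Hom-sets are indexed by their source and target, so they need not be disjoint and
   composition takes the three objects as arguments: for f in Hom x y and g in Hom y z,
   Comp x y z g f is "g after f".  Since the objects form a set, every such category is
   small, so "essentially small" imposes no further condition. *)
record ('o, 'm) category =
  Obj :: "'o set"
  Hom :: "'o \<Rightarrow> 'o \<Rightarrow> 'm set"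
  Id :: "'o \<Rightarrow> 'm"
  Comp :: "'o \<Rightarrow> 'o \<Rightarrow> 'o \<Rightarrow> 'm \<Rightarrow> 'm \<Rightarrow> 'm"

locale category =
  fixes C :: "('o, 'm) category"
  assumes Id_in_Hom: "x \<in> Obj C \<Longrightarrow> Id C x \<in> Hom C x x"
    and Comp_in_Hom:
      "\<lbrakk>x \<in> Obj C; y \<in> Obj C; z \<in> Obj C; f \<in> Hom C x y; g \<in> Hom C y z\<rbrakk>
        \<Longrightarrow> Comp C x y z g f \<in> Hom C x z"
    and Id_left: "\<lbrakk>x \<in> Obj C; y \<in> Obj C; f \<in> Hom C x y\<rbrakk> \<Longrightarrow> Comp C x y y (Id C y) f = f"
    and Id_right: "\<lbrakk>x \<in> Obj C; y \<in> Obj C; f \<in> Hom C x y\<rbrakk> \<Longrightarrow> Comp C x x y f (Id C x) = f"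
    and Comp_assoc:
      "\<lbrakk>w \<in> Obj C; x \<in> Obj C; y \<in> Obj C; z \<in> Obj C;
        f \<in> Hom C w x; g \<in> Hom C x y; h \<in> Hom C y z\<rbrakk>
        \<Longrightarrow> Comp C w y z h (Comp C w x y g f) = Comp C w x z (Comp C x y z h g) f"

definition isomorphic :: "('o, 'm) category \<Rightarrow> 'o \<Rightarrow> 'o \<Rightarrow> bool" where
  "isomorphic C x y \<longleftrightarrow>
     (\<exists>f\<in>Hom C x y. \<exists>g\<in>Hom C y x. Comp C x y x g f = Id C x \<and> Comp C y x y f g = Id C y)"

(* Fo is the object map and Fm y z the map on morphisms from y to z. *)
locale functor_between = source: category C + target: category D
  for C :: "('o, 'm) category" and D :: "('p, 'n) category"
    and Fo :: "'o \<Rightarrow> 'p" and Fm :: "'o \<Rightarrow> 'o \<Rightarrow> 'm \<Rightarrow> 'n" +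
  assumes Fo_in_Obj: "x \<in> Obj C \<Longrightarrow> Fo x \<in> Obj D"
    and Fm_in_Hom: "\<lbrakk>x \<in> Obj C; y \<in> Obj C; f \<in> Hom C x y\<rbrakk> \<Longrightarrow> Fm x y f \<in> Hom D (Fo x) (Fo y)"
    and Fm_Id: "x \<in> Obj C \<Longrightarrow> Fm x x (Id C x) = Id D (Fo x)"
    and Fm_Comp:
      "\<lbrakk>x \<in> Obj C; y \<in> Obj C; z \<in> Obj C; f \<in> Hom C x y; g \<in> Hom C y z\<rbrakk>
        \<Longrightarrow> Fm x z (Comp C x y z g f) = Comp D (Fo x) (Fo y) (Fo z) (Fm y z g) (Fm x y f)"

definition essentially_surjective ::
    "('o, 'm) category \<Rightarrow> ('p, 'n) category \<Rightarrow> ('o \<Rightarrow> 'p) \<Rightarrow> bool" where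
  "essentially_surjective C D Fo \<longleftrightarrow> (\<forall>x\<in>Obj D. \<exists>y\<in>Obj C. isomorphic D (Fo y) x)"

definition property_F ::
    "('o, 'm) category \<Rightarrow> ('p, 'n) category \<Rightarrow> ('o \<Rightarrow> 'p) \<Rightarrow> ('o \<Rightarrow> 'o \<Rightarrow> 'm \<Rightarrow> 'n) \<Rightarrow> bool" where
  "property_F C' C Fo Fm \<longleftrightarrow>
     (\<forall>x\<in>Obj C. \<exists>(n::nat) y f.
        (\<forall>i<n. y i \<in> Obj C' \<and> f i \<in> Hom C x (Fo (y i))) \<and>
        (\<forall>z\<in>Obj C'. \<forall>k\<in>Hom C x (Fo z).
           \<exists>i<n. \<exists>g\<in>Hom C' (y i) z. k = Comp C x (Fo (y i)) (Fo z) (Fm (y i) z g) (f i)))"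

definition is_ordering :: "('o, 'm) category \<Rightarrow> 'o \<Rightarrow> ('o \<Rightarrow> 'm rel) \<Rightarrow> bool" where
  "is_ordering C x r \<longleftrightarrow>
     (\<forall>y\<in>Obj C. well_order_on (Hom C x y) (r y)) \<and>
     (\<forall>y\<in>Obj C. \<forall>z\<in>Obj C. \<forall>h\<in>Hom C y z. \<forall>f\<in>Hom C x y. \<forall>g\<in>Hom C x y.
        (f, g) \<in> r y \<and> f \<noteq> g \<longrightarrow>
        (Comp C x y z h f, Comp C x y z h g) \<in> r z \<and> Comp C x y z h f \<noteq> Comp C x y z h g)"

definition orderable :: "('o, 'm) category \<Rightarrow> 'o \<Rightarrow> bool" where
  "orderable C x \<longleftrightarrow> (\<exists>r. is_ordering C x r)"

(* An element f of S_x(y) is represented in the coproduct over y as the pair (y, f). *)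
definition from_object :: "('o, 'm) category \<Rightarrow> 'o \<Rightarrow> ('o \<times> 'm) set" where
  "from_object C x = Sigma (Obj C) (Hom C x)"

definition from_le :: "('o, 'm) category \<Rightarrow> 'o \<Rightarrow> ('o \<times> 'm) rel" where
  "from_le C x = {((y, f), (z, g)).
     (y, f) \<in> from_object C x \<and> (z, g) \<in> from_object C x \<and>
     (\<exists>h\<in>Hom C y z. g = Comp C x y z h f)}"

definition from_equiv :: "('o, 'm) category \<Rightarrow> 'o \<Rightarrow> ('o \<times> 'm) rel" where
  "from_equiv C x = from_le C x \<inter> (from_le C x)\<inverse>"

definition poset_carrier :: "('o, 'm) category \<Rightarrow> 'o \<Rightarrow> ('o \<times> 'm) set set" where
  "poset_carrier C x = from_object C x // from_equiv C x"

definition poset_le :: "('o, 'm) category \<Rightarrow> 'o \<Rightarrow> ('o \<times> 'm) set rel" where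
  "poset_le C x = {(A, B). A \<in> poset_carrier C x \<and> B \<in> poset_carrier C x \<and>
     (\<exists>p\<in>A. \<exists>q\<in>B. (p, q) \<in> from_le C x)}"

definition noetherian_on :: "'a set \<Rightarrow> 'a rel \<Rightarrow> bool" where
  "noetherian_on A r \<longleftrightarrow>
     (\<forall>s::nat \<Rightarrow> 'a. (\<forall>n. s n \<in> A) \<longrightarrow> (\<exists>i j. i < j \<and> (s i, s j) \<in> r))"

definition groebner :: "('o, 'm) category \<Rightarrow> bool" where
  "groebner C \<longleftrightarrow>
     category C \<and>
     (\<forall>x\<in>Obj C. orderable C x \<and> noetherian_on (poset_carrier C x) (poset_le C x))"

(* HOL cannot quantify over types inside a formula, so C' ranges over categories on fixed
   types.  This loses nothing: closing the morphisms of an arbitrary witness under finite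
   composition and under the existential requirements in the definitions (starting from
   enough objects for essential surjectivity and property (F)) gives a subcategory that is
   still a witness and has at most max(|'o|, |'m|, aleph_0) morphisms; it embeds into
   these types. *)
definition quasi_groebner :: "('o, 'm) category \<Rightarrow> bool" where
  "quasi_groebner C \<longleftrightarrow>
     category C \<and>
     (\<exists>(C' :: ('o \<times> nat, 'o \<times> 'm \<times> nat) category) Fo Fm.
        groebner C' \<and> functor_between C' C Fo Fm \<and>
        essentially_surjective C' C Fo \<and> property_F C' C Fo Fm)"

(* A G-map R -> S; both components are extensional (undefined off R), so that equal
   G-maps are equal as pairs. *)
definition G_maps ::
    "('g, 'b) monoid_scheme \<Rightarrow> 'a set \<Rightarrow> 'c set \<Rightarrow> (('a \<Rightarrow> 'c) \<times> ('a \<Rightarrow> 'g)) set" where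
  "G_maps G R S = (R \<rightarrow>\<^sub>E S) \<times> (R \<rightarrow>\<^sub>E carrier G)"

definition G_map_comp ::
    "('g, 'b) monoid_scheme \<Rightarrow> 'a set \<Rightarrow> ('c \<Rightarrow> 'd) \<times> ('c \<Rightarrow> 'g) \<Rightarrow>
       ('a \<Rightarrow> 'c) \<times> ('a \<Rightarrow> 'g) \<Rightarrow> ('a \<Rightarrow> 'd) \<times> ('a \<Rightarrow> 'g)" where
  "G_map_comp G R = (\<lambda>(g, \<sigma>) (f, \<rho>).
     (\<lambda>x\<in>R. g (f x), \<lambda>x\<in>R. \<sigma> (f x) \<otimes>\<^bsub>G\<^esub> \<rho> x))"

(* The finite sets are the finite subsets of a type 'a.  The class constraint "infinite"
   guarantees that finite sets of every cardinality occur. *)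
definition FI ::
    "('g, 'b) monoid_scheme \<Rightarrow> ('a::infinite set, ('a \<Rightarrow> 'a) \<times> ('a \<Rightarrow> 'g)) category" where
  "FI G = \<lparr>Obj = {R. finite R},
     Hom = (\<lambda>R S. {(f, \<rho>) \<in> G_maps G R S. inj_on f R}),
     Id = (\<lambda>R. (\<lambda>x\<in>R. x, \<lambda>x\<in>R. \<one>\<^bsub>G\<^esub>)),
     Comp = (\<lambda>R S T. G_map_comp G R)\<rparr>"

lemma category_FI:
  assumes "group G"
  shows "category (FI G)"
proof -
  interpret group G by fact
  show ?thesis
    by standard
      (auto simp: FI_def G_maps_def G_map_comp_def inj_on_def PiE_iff extensional_def
        fun_eq_iff m_assoc restrict_def)
qed

lemma equiv_from_equiv:
  assumes "category C" "x \<in> Obj C"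
  shows "equiv (from_object C x) (from_equiv C x)"
proof -
  interpret category C by fact
  have tr: "trans (from_le C x)"
  proof (rule transI)
    fix p q r assume "(p, q) \<in> from_le C x" "(q, r) \<in> from_le C x"
    then show "(p, r) \<in> from_le C x"
      using assms(2) Comp_in_Hom Comp_assoc
      by (clarsimp simp: from_le_def from_object_def) metis
  qed
  have rf: "(p, p) \<in> from_le C x" if "p \<in> from_object C x" for p
    using that assms(2) Id_in_Hom Id_left by (force simp: from_le_def from_object_def)
  show ?thesis
    unfolding from_equiv_def
  proof (rule equivI)
    show "from_le C x \<inter> (from_le C x)\<inverse> \<subseteq> from_object C x \<times> from_object C x"
      by (auto simp: from_le_def)
    show "refl_on (from_object C x) (from_le C x \<inter> (from_le C x)\<inverse>)"
      using rf by (auto simp: refl_on_def)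
    show "sym (from_le C x \<inter> (from_le C x)\<inverse>)"
      by (auto simp: sym_def)
    show "trans (from_le C x \<inter> (from_le C x)\<inverse>)"
      using tr by (simp add: trans_Int)
  qed
qed

end

theory Submission
  imports Defs Complex_Main "HOL-Library.Countable_Set" "HOL-Library.Infinite_Set"
begin

text \<open>
  The Groebner category that witnesses the theorem is the wide subcategory \<open>OI\<close> of
  \<open>FI G\<close> whose morphisms are the increasing maps with all labels \<open>\<one>\<close>, where every
  finite set is linearly ordered by a chosen enumeration. Labels have to be left out of it: a
  nontrivial finite group has no total order that is strictly preserved by left multiplication,
  so \<open>G\<close> itself must enter through property (F) only.

  Property (F) for the inclusion holds because an injection \<open>R \<rightarrow> S\<close> labelled in \<open>G\<close> is an
  automorphism of \<open>R\<close> in \<open>FI G\<close>, which carries the reordering and all labels, followed by the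
  increasing enumeration of the image (\<open>FI_map_factors_OI\<close>). As \<open>G\<close> is finite, the
  automorphism group of \<open>R\<close> is finite, and its elements are the required finitely many maps.

  \<open>OI\<close> is Groebner for two reasons. Comparing increasing maps \<open>R \<rightarrow> S\<close> lexicographically
  gives a well-order, since there are finitely many, and it is preserved by postcomposition with
  an increasing map (\<open>orderable_OI\<close>). Next, an increasing map \<open>f\<close> from \<open>R\<close> to \<open>S\<close> divides \<open>S\<close>
  into the points of the image and the gaps between them, and \<open>f\<close> lies below \<open>g\<close> as soon as
  each gap of \<open>f\<close> has at most as many elements as the corresponding gap of \<open>g\<close>
  (\<open>increasing_extension\<close>). The number of gaps depends on \<open>R\<close> only, so Dickson's lemma
  makes the poset noetherian (\<open>noetherian_OI\<close>).
\<close>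

section \<open>Changing the types of a Groebner witness\<close>

text \<open>
  The definition of quasi-Groebner categories looks for a witness whose objects and morphisms live
  in product types. Attaching dummy components makes an isomorphic copy of any witness on the
  types of the given category; the lemmas below show that nothing else changes.
\<close>

definition tagged :: "('o, 'm) category \<Rightarrow> ('o \<times> nat, 'o \<times> 'm \<times> nat) category" where
  "tagged D = \<lparr>Obj = Obj D \<times> {0},
     Hom = (\<lambda>(x, _) (y, _). (\<lambda>f. (x, f, 0)) ` Hom D x y),
     Id = (\<lambda>(x, _). (x, Id D x, 0)),
     Comp = (\<lambda>(x, _) (y, _) (z, _) (_, g, _) (_, f, _). (x, Comp D x y z g f, 0))\<rparr>"

lemma category_tagged:
  assumes "category D"
  shows "category (tagged D)"
proof -
  interpret category D by fact
  show ?thesis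
    by standard (auto simp: tagged_def Id_in_Hom Comp_in_Hom Id_left Id_right Comp_assoc)
qed

text \<open>
  This lemma and the next one replace sequences of equivalence classes in \<open>|S\<^sub>x|\<close> by sequences of
  morphisms out of \<open>x\<close>: the order on classes can be tested on any representatives, because the
  relation on morphisms is transitive.
\<close>

lemma noetherian_quotientI:
  assumes "category C" and x: "x \<in> Obj C"
    and good: "\<And>s :: nat \<Rightarrow> _. (\<And>n. s n \<in> from_object C x) \<Longrightarrow>
      \<exists>i j. i < j \<and> (s i, s j) \<in> from_le C x"
  shows "noetherian_on (poset_carrier C x) (poset_le C x)"
  unfolding noetherian_on_def
proof (intro allI impI)
  fix s :: "nat \<Rightarrow> _" assume s: "\<forall>n. s n \<in> poset_carrier C x"
  note eq = equiv_from_equiv[OF assms(1,2)]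
  have s': "s n \<in> from_object C x // from_equiv C x" for n
    using s by (simp add: poset_carrier_def)
  have "\<exists>p. p \<in> s n" for n
    using in_quotient_imp_non_empty[OF eq s'[of n]] by auto
  then obtain p where p: "\<And>n. p n \<in> s n" by metis
  have "p n \<in> from_object C x" for n
    using in_quotient_imp_subset[OF eq s'[of n]] p[of n] by auto
  from good[OF this] obtain i j where "i < j" "(p i, p j) \<in> from_le C x" by blast
  moreover from this have "(s i, s j) \<in> poset_le C x"
    using s p[of i] p[of j] by (auto simp: poset_le_def)
  ultimately show "\<exists>i j. i < j \<and> (s i, s j) \<in> poset_le C x" by blast
qed

lemma noetherian_quotientD:
  assumes "category C" and x: "x \<in> Obj C"
    and noeth: "noetherian_on (poset_carrier C x) (poset_le C x)"
    and s: "\<And>n :: nat. s n \<in> from_object C x"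
  shows "\<exists>i j. i < j \<and> (s i, s j) \<in> from_le C x"
proof -
  interpret category C by fact
  note eq = equiv_from_equiv[OF assms(1,2)]
  have tr: "(p, r) \<in> from_le C x" if "(p, q) \<in> from_le C x" "(q, r) \<in> from_le C x" for p q r
    using that x Comp_in_Hom Comp_assoc
    by (clarsimp simp: from_le_def from_object_def) metis
  have "from_equiv C x `` {s n} \<in> poset_carrier C x" for n
    using s by (simp add: poset_carrier_def quotientI)
  then obtain i j where ij: "i < j"
    "(from_equiv C x `` {s i}, from_equiv C x `` {s j}) \<in> poset_le C x"
    using noeth[unfolded noetherian_on_def, rule_format, of "\<lambda>n. from_equiv C x `` {s n}"]
    by blast
  then obtain p q where "(s i, p) \<in> from_equiv C x" "(s j, q) \<in> from_equiv C x"
    "(p, q) \<in> from_le C x"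
    unfolding poset_le_def by blast
  then have "(s i, p) \<in> from_le C x" "(p, q) \<in> from_le C x" "(q, s j) \<in> from_le C x"
    by (auto simp: from_equiv_def)
  then have "(s i, s j) \<in> from_le C x" using tr by meson
  with ij show ?thesis by blast
qed

lemma groebner_tagged:
  assumes "groebner D"
  shows "groebner (tagged D)"
  unfolding groebner_def
proof (intro conjI ballI)
  have cat: "category D" using assms by (simp add: groebner_def)
  show cat': "category (tagged D)" by (rule category_tagged) fact
  fix x' assume x': "x' \<in> Obj (tagged D)"
  then obtain x where x: "x' = (x, 0)" "x \<in> Obj D" by (auto simp: tagged_def)
  obtain r where r: "is_ordering D x r"
    using assms x(2) unfolding groebner_def orderable_def by blast
  let ?tag = "\<lambda>f :: 'b. (x, f, 0 :: nat)"
  have "is_ordering (tagged D) x' (\<lambda>(y, _). dir_image (r y) ?tag)"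
    unfolding is_ordering_def
  proof (intro conjI ballI impI)
    fix y' assume "y' \<in> Obj (tagged D)"
    then obtain y where y: "y' = (y, 0)" "y \<in> Obj D" by (auto simp: tagged_def)
    have wo: "well_order_on (Hom D x y) (r y)"
      using r y unfolding is_ordering_def by blast
    have "Well_order (dir_image (r y) ?tag)"
      using well_order_on_Well_order[OF wo] by (intro Well_order_dir_image) (auto simp: inj_on_def)
    moreover have "Field (dir_image (r y) ?tag) = Hom (tagged D) x' y'"
      using well_order_on_Well_order[OF wo] by (simp add: dir_image_Field x y tagged_def)
    ultimately show "well_order_on (Hom (tagged D) x' y')
        ((\<lambda>(y, _). dir_image (r y) ?tag) y')"
      by (simp add: y)
  next
    fix y' z' h' f' g'
    assume "y' \<in> Obj (tagged D)" "z' \<in> Obj (tagged D)" "h' \<in> Hom (tagged D) y' z'"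
      and fg': "f' \<in> Hom (tagged D) x' y'" "g' \<in> Hom (tagged D) x' y'"
        "(f', g') \<in> (\<lambda>(y, _). dir_image (r y) ?tag) y' \<and> f' \<noteq> g'"
    then obtain y z h where yz: "y' = (y, 0)" "z' = (z, 0)" "y \<in> Obj D" "z \<in> Obj D"
      and h: "h' = (y, h, 0)" "h \<in> Hom D y z"
      by (auto simp: tagged_def)
    obtain f where f: "f' = ?tag f" "f \<in> Hom D x y"
      using fg'(1) by (auto simp: tagged_def x(1) yz(1))
    obtain g where g: "g' = ?tag g" "g \<in> Hom D x y"
      using fg'(2) by (auto simp: tagged_def x(1) yz(1))
    have fg: "(f, g) \<in> r y" "f \<noteq> g"
      using fg'(3) by (auto simp: yz(1) f(1) g(1) dir_image_def)
    have *: "(Comp D x y z h f, Comp D x y z h g) \<in> r z \<and> Comp D x y z h f \<noteq> Comp D x y z h g"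
      using conjunct2[OF r[unfolded is_ordering_def], rule_format, OF yz(3,4) h(2) f(2) g(2)] fg
      by blast
    show "(Comp (tagged D) x' y' z' h' f', Comp (tagged D) x' y' z' h' g')
        \<in> (\<lambda>(y, _). dir_image (r y) ?tag) z'"
      "Comp (tagged D) x' y' z' h' f' \<noteq> Comp (tagged D) x' y' z' h' g'"
      using * by (auto simp: x(1) yz(1,2) h(1) f(1) g(1) tagged_def dir_image_def)
  qed
  then show "orderable (tagged D) x'" unfolding orderable_def by blast
  show "noetherian_on (poset_carrier (tagged D) x') (poset_le (tagged D) x')"
  proof (rule noetherian_quotientI[OF cat' x'])
    fix s :: "nat \<Rightarrow> _" assume s: "\<And>n. s n \<in> from_object (tagged D) x'"
    define y where "y n = fst (fst (s n))" for n
    define f where "f n = fst (snd (snd (s n)))" for n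
    have yf: "y n \<in> Obj D" "f n \<in> Hom D x (y n)" and s_eq: "s n = ((y n, 0), ?tag (f n))" for n
      using s[of n] by (auto simp: from_object_def tagged_def x(1) y_def f_def)
    have "noetherian_on (poset_carrier D x) (poset_le D x)"
      using assms x(2) unfolding groebner_def by blast
    moreover have "(y n, f n) \<in> from_object D x" for n
      using yf by (simp add: from_object_def)
    ultimately have "\<exists>i j. i < j \<and> ((y i, f i), (y j, f j)) \<in> from_le D x"
      by (rule noetherian_quotientD[OF cat x(2)])
    then obtain i j where "i < j" "((y i, f i), (y j, f j)) \<in> from_le D x" by blast
    then have "(s i, s j) \<in> from_le (tagged D) x'"
      by (auto simp: s_eq from_le_def from_object_def tagged_def x(1))
    with \<open>i < j\<close> show "\<exists>i j. i < j \<and> (s i, s j) \<in> from_le (tagged D) x'" by blast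
  qed
qed

lemma quasi_groebnerI:
  fixes C D :: "('o, 'm) category"
  assumes D: "groebner D" and fun_F: "functor_between D C Fo Fm"
    and es: "essentially_surjective D C Fo" and pF: "property_F D C Fo Fm"
  shows "quasi_groebner C"
proof -
  interpret functor_between D C Fo Fm by fact
  interpret tag: category "tagged D" by (rule category_tagged) (rule source.category_axioms)
  let ?Fo = "\<lambda>(x, _ :: nat). Fo x"
    and ?Fm = "\<lambda>(x, _ :: nat) (y, _ :: nat) (_ :: 'o, f, _ :: nat). Fm x y f"
  have "functor_between (tagged D) C ?Fo ?Fm"
    by standard (auto simp: tagged_def Fo_in_Obj Fm_in_Hom Fm_Id Fm_Comp)
  moreover have "essentially_surjective (tagged D) C ?Fo"
    using es by (fastforce simp: essentially_surjective_def tagged_def)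
  moreover have "property_F (tagged D) C ?Fo ?Fm"
    unfolding property_F_def
  proof
    fix x assume "x \<in> Obj C"
    then obtain n :: nat and y f where
      yf: "\<forall>i<n. y i \<in> Obj D \<and> f i \<in> Hom C x (Fo (y i))" and
      fac: "\<forall>z\<in>Obj D. \<forall>k\<in>Hom C x (Fo z).
           \<exists>i<n. \<exists>g\<in>Hom D (y i) z. k = Comp C x (Fo (y i)) (Fo z) (Fm (y i) z g) (f i)"
      using pF unfolding property_F_def by blast
    show "\<exists>(n::nat) y f.
        (\<forall>i<n. y i \<in> Obj (tagged D) \<and> f i \<in> Hom C x (?Fo (y i))) \<and>
        (\<forall>z\<in>Obj (tagged D). \<forall>k\<in>Hom C x (?Fo z). \<exists>i<n. \<exists>g\<in>Hom (tagged D) (y i) z.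
           k = Comp C x (?Fo (y i)) (?Fo z) (?Fm (y i) z g) (f i))"
      by (rule exI[of _ n], rule exI[of _ "\<lambda>i. (y i, 0)"], rule exI[of _ f])
        (use yf fac in \<open>auto simp: tagged_def\<close>)
  qed
  ultimately show ?thesis
    unfolding quasi_groebner_def
    using groebner_tagged[OF D] target.category_axioms by blast
qed

section \<open>Dickson's lemma\<close>

text \<open>
  Every sequence has a monotone subsequence, and a decreasing sequence of natural numbers is
  constant from the place where its minimum is attained.
\<close>

lemma nat_seq_has_incseq_subseq:
  fixes s :: "nat \<Rightarrow> nat"
  shows "\<exists>\<phi>. strict_mono \<phi> \<and> incseq (\<lambda>n. s (\<phi> n))"
proof -
  obtain \<phi> where \<phi>: "strict_mono \<phi>" "monoseq (\<lambda>n. s (\<phi> n))"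
    using seq_monosub by blast
  show ?thesis
  proof (cases "incseq (\<lambda>n. s (\<phi> n))")
    case True
    with \<phi> show ?thesis by blast
  next
    case False
    then have dec: "decseq (\<lambda>n. s (\<phi> n))" using \<phi>(2) by (simp add: monoseq_iff)
    obtain N where N: "\<And>n. s (\<phi> N) \<le> s (\<phi> n)"
      using ex_has_least_nat[of "\<lambda>_. True" _ "\<lambda>n. s (\<phi> n)"] by auto
    have "s (\<phi> (N + n)) = s (\<phi> N)" for n
      using decseqD[OF dec, of N "N + n"] N[of "N + n"] by simp
    then have "incseq (\<lambda>n. s (\<phi> (N + n)))" by (simp add: incseq_def)
    moreover have "strict_mono (\<lambda>n. \<phi> (N + n))"
      using \<phi>(1) by (simp add: strict_mono_def)
    ultimately show ?thesis by blast
  qed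
qed

text \<open>
  Passing to a subsequence keeps the coordinates that are already increasing, so the coordinates
  can be treated one after the other.
\<close>

lemma dickson_subseq:
  fixes v :: "nat \<Rightarrow> 'k \<Rightarrow> nat"
  assumes "finite K"
  shows "\<exists>\<phi>. strict_mono \<phi> \<and> (\<forall>k\<in>K. incseq (\<lambda>n. v (\<phi> n) k))"
  using assms
proof (induction K rule: finite_induct)
  case empty
  show ?case using strict_mono_id by auto
next
  case (insert k K)
  then obtain \<phi> where \<phi>: "strict_mono \<phi>" "\<And>l. l \<in> K \<Longrightarrow> incseq (\<lambda>n. v (\<phi> n) l)" by blast
  obtain \<psi> where \<psi>: "strict_mono \<psi>" "incseq (\<lambda>n. v (\<phi> (\<psi> n)) k)"
    using nat_seq_has_incseq_subseq[of "\<lambda>n. v (\<phi> n) k"] by blast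
  have "incseq (\<lambda>n. v (\<phi> (\<psi> n)) l)" if "l \<in> K" for l
    using \<phi>(2)[OF that] strict_mono_mono[OF \<psi>(1)] by (simp add: incseq_def mono_def)
  moreover have "strict_mono (\<lambda>n. \<phi> (\<psi> n))"
    using \<phi>(1) \<psi>(1) by (simp add: strict_mono_def)
  ultimately show ?case using \<psi>(2) by blast
qed

corollary dickson:
  fixes v :: "nat \<Rightarrow> 'k \<Rightarrow> nat"
  assumes "finite K"
  obtains i j where "i < j" "\<And>k. k \<in> K \<Longrightarrow> v i k \<le> v j k"
proof -
  obtain \<phi> where "strict_mono \<phi>" "\<And>k. k \<in> K \<Longrightarrow> incseq (\<lambda>n. v (\<phi> n) k)"
    using dickson_subseq[OF assms] by blast
  then show ?thesis
    using that[of "\<phi> 0" "\<phi> 1"] by (auto simp: strict_mono_def incseq_def)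
qed

section \<open>Increasing maps between finite sets\<close>

text \<open>
  Linear orders on finite sets are given by injective ranks in \<open>nat\<close>, so that one type can carry
  a separate order for each of its finite subsets.
\<close>

definition increasing :: "('a \<Rightarrow> nat) \<Rightarrow> ('b \<Rightarrow> nat) \<Rightarrow> 'a set \<Rightarrow> ('a \<Rightarrow> 'b) \<Rightarrow> bool" where
  "increasing p q R f \<longleftrightarrow> (\<forall>a\<in>R. \<forall>b\<in>R. p a < p b \<longrightarrow> q (f a) < q (f b))"

lemma increasing_imp_inj_on: "increasing p q R f \<Longrightarrow> inj_on p R \<Longrightarrow> inj_on f R"
  unfolding increasing_def inj_on_def by (metis linorder_neqE_nat order_less_irrefl)

lemma ex_increasing_map:
  fixes p :: "'a \<Rightarrow> nat" and q :: "'b \<Rightarrow> nat"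
  assumes "finite K" "finite L" "inj_on p K" "inj_on q L" "card K \<le> card L"
  obtains g where "g ` K \<subseteq> L" "increasing p q K g"
proof -
  have cards: "card (p ` K) = card K" "card (q ` L) = card L"
    using assms by (simp_all add: card_image)
  obtain h where h: "bij_betw h {..<card K} (p ` K)" "strict_mono_on {..<card K} h"
    using ex_bij_betw_strict_mono_card[of "p ` K"] assms cards by auto
  obtain h' where h': "bij_betw h' {..<card L} (q ` L)" "strict_mono_on {..<card L} h'"
    using ex_bij_betw_strict_mono_card[of "q ` L"] assms cards by auto
  have "\<exists>n<card K. p a = h n" if "a \<in> K" for a
    using h(1) that unfolding bij_betw_def by blast
  then obtain rank where rank: "\<And>a. a \<in> K \<Longrightarrow> rank a < card K" "\<And>a. a \<in> K \<Longrightarrow> p a = h (rank a)"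
    by metis
  have "\<exists>b\<in>L. q b = h' n" if "n < card L" for n
    using h'(1) that unfolding bij_betw_def by (metis imageE imageI lessThan_iff)
  then obtain nth where nth: "\<And>n. n < card L \<Longrightarrow> nth n \<in> L" "\<And>n. n < card L \<Longrightarrow> q (nth n) = h' n"
    by metis
  \<comment> \<open>The embedding sends the \<open>n\<close>-th element of \<open>K\<close> to the \<open>n\<close>-th element of \<open>L\<close>.\<close>
  have rank_less: "rank a < rank b" if "a \<in> K" "b \<in> K" "p a < p b" for a b
  proof (rule ccontr)
    assume "\<not> rank a < rank b"
    then consider "rank a = rank b" | "rank b < rank a" by linarith
    then show False
      by cases (use that rank h(2) in \<open>force simp: strict_mono_on_def\<close>)+
  qed
  show ?thesis
  proof
    show "(\<lambda>a. nth (rank a)) ` K \<subseteq> L" using nth rank assms(5) by force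
    show "increasing p q K (\<lambda>a. nth (rank a))"
      unfolding increasing_def
    proof (intro ballI impI)
      fix a b assume ab: "a \<in> K" "b \<in> K" "p a < p b"
      have "rank a < card L" "rank b < card L"
        using rank(1) ab assms(5) by force+
      then show "q (nth (rank a)) < q (nth (rank b))"
        using nth(2) h'(2) rank_less[OF ab] by (simp add: strict_mono_on_def)
    qed
  qed
qed

text \<open>
  The increasing part \<open>g\<close> enumerates the image of \<open>f\<close> in its own order; what remains of \<open>f\<close> is a
  permutation.
\<close>

lemma injection_factors_increasing:
  fixes f :: "'a \<Rightarrow> 'b"
  assumes "finite R" "finite S" "inj_on p R" "inj_on q S" "f ` R \<subseteq> S" "inj_on f R"
  obtains \<sigma> g where "bij_betw \<sigma> R R" "g ` R \<subseteq> S" "increasing p q R g"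
    "\<And>a. a \<in> R \<Longrightarrow> g (\<sigma> a) = f a"
proof -
  have fin: "finite (f ` R)" and c: "card (f ` R) = card R"
    using assms by (simp_all add: card_image)
  have "inj_on q (f ` R)" using assms by (meson inj_on_subset)
  then obtain g where g: "g ` R \<subseteq> f ` R" "increasing p q R g"
    using ex_increasing_map[of R "f ` R" p q] assms fin c by auto
  have inj_g: "inj_on g R" using increasing_imp_inj_on g assms by blast
  have "bij_betw g R (f ` R)"
    using card_subset_eq[OF fin g(1)] c card_image[OF inj_g] inj_g by (simp add: bij_betw_def)
  moreover have "bij_betw f R (f ` R)" using assms by (simp add: bij_betw_def)
  ultimately have "bij_betw (inv_into R g \<circ> f) R R"
    using bij_betw_trans bij_betw_inv_into by blast
  moreover have "g ((inv_into R g \<circ> f) a) = f a" if "a \<in> R" for a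
    using that \<open>bij_betw g R (f ` R)\<close> by (simp add: bij_betw_inv_into_right)
  ultimately show ?thesis using that g assms by blast
qed

text \<open>
  The position of \<open>s\<close> relative to the values of \<open>f\<close>. For injective \<open>f\<close> and \<open>q\<close>, the two sets are equal when \<open>s\<close> lies in a gap
  and differ by the one preimage of \<open>s\<close> when \<open>s\<close> is a value, so the fibres of \<open>cut_at q R f\<close> are the gaps
  and the single values. Recording both sets treats these two kinds of points alike.
\<close>

definition cut_at :: "('b \<Rightarrow> nat) \<Rightarrow> 'a set \<Rightarrow> ('a \<Rightarrow> 'b) \<Rightarrow> 'b \<Rightarrow> 'a set \<times> 'a set" where
  "cut_at q R f s = ({a \<in> R. q (f a) < q s}, {a \<in> R. q (f a) \<le> q s})"

text \<open>
  Map each fibre of \<open>cut_at q R f\<close> increasingly into the fibre of \<open>cut_at r R g\<close> over the same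
  pair of subsets of \<open>R\<close>. The resulting \<open>h\<close> preserves positions relative to the elements of \<open>R\<close>.
  Hence \<open>h (f a)\<close> is neither below nor above \<open>g a\<close>, and two points in different fibres stay in
  order because the value of some \<open>a\<close> separates them.
\<close>

lemma increasing_extension:
  fixes f :: "'a \<Rightarrow> 'b" and g :: "'a \<Rightarrow> 'c"
  assumes fin: "finite S" "finite T" and inj: "inj_on q S" "inj_on r T"
    and f: "f ` R \<subseteq> S" and g: "g ` R \<subseteq> T"
    and le: "\<And>k. k \<in> Pow R \<times> Pow R \<Longrightarrow>
      card {s \<in> S. cut_at q R f s = k} \<le> card {t \<in> T. cut_at r R g t = k}"
  obtains h where "h ` S \<subseteq> T" "increasing q r S h" "\<And>a. a \<in> R \<Longrightarrow> h (f a) = g a"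
proof -
  define X where "X k = {s \<in> S. cut_at q R f s = k}" for k
  define Y where "Y k = {t \<in> T. cut_at r R g t = k}" for k
  have "\<exists>e. e ` X k \<subseteq> Y k \<and> increasing q r (X k) e" if k: "k \<in> Pow R \<times> Pow R" for k
  proof -
    have "inj_on q (X k)" "inj_on r (Y k)"
      using inj by (auto simp: X_def Y_def intro: inj_on_subset)
    moreover have "finite (X k)" "finite (Y k)" "card (X k) \<le> card (Y k)"
      using fin le[OF k] by (simp_all add: X_def Y_def)
    ultimately show ?thesis
      using ex_increasing_map[of "X k" "Y k" q r] by metis
  qed
  then obtain e where e: "\<And>k. k \<in> Pow R \<times> Pow R \<Longrightarrow> e k ` X k \<subseteq> Y k"
    "\<And>k. k \<in> Pow R \<times> Pow R \<Longrightarrow> increasing q r (X k) (e k)"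
    by metis
  define h where "h s = e (cut_at q R f s) s" for s
  have cut_in: "cut_at q R f s \<in> Pow R \<times> Pow R" for s by (auto simp: cut_at_def)
  have hY: "h s \<in> Y (cut_at q R f s)" if "s \<in> S" for s
    using e(1)[OF cut_in[of s]] that by (auto simp: h_def X_def)
  then have hT: "h s \<in> T" and cut_h: "cut_at r R g (h s) = cut_at q R f s" if "s \<in> S" for s
    using that by (auto simp: Y_def)
  have less_h: "r (g a) < r (h s) \<longleftrightarrow> q (f a) < q s"
    and le_h: "r (g a) \<le> r (h s) \<longleftrightarrow> q (f a) \<le> q s" if "a \<in> R" "s \<in> S" for a s
    using cut_h[OF that(2)] that(1) by (auto simp: cut_at_def set_eq_iff)
  show ?thesis
  proof
    show "h ` S \<subseteq> T" using hT by blast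
    show "h (f a) = g a" if a: "a \<in> R" for a
    proof -
      have "f a \<in> S" using a f by blast
      then have "r (h (f a)) = r (g a)"
        using less_h[OF a] le_h[OF a] by (metis le_less less_irrefl)
      then show ?thesis
        using inj(2) hT[OF \<open>f a \<in> S\<close>] a g by (meson image_subset_iff inj_onD)
    qed
    show "increasing q r S h"
      unfolding increasing_def
    proof (intro ballI impI)
      fix s s' assume s: "s \<in> S" "s' \<in> S" "q s < q s'"
      show "r (h s) < r (h s')"
      proof (cases "cut_at q R f s = cut_at q R f s'")
        case True
        then have "s \<in> X (cut_at q R f s)" "s' \<in> X (cut_at q R f s)" using s by (auto simp: X_def)
        then have "r (e (cut_at q R f s) s) < r (e (cut_at q R f s) s')"
          using e(2)[OF cut_in[of s]] s(3) unfolding increasing_def by blast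
        then show ?thesis by (simp add: h_def True)
      next
        case False
        \<comment> \<open>Both components of the cut grow with the point, so a change in one of them provides an
            \<open>a\<close> that was passed strictly or reached between \<open>s\<close> and \<open>s'\<close>.\<close>
        then obtain a where a: "a \<in> R"
          "(q (f a) < q s' \<and> \<not> q (f a) < q s) \<or> (q (f a) \<le> q s' \<and> \<not> q (f a) \<le> q s)"
          using s(3) by (fastforce simp: cut_at_def)
        then show ?thesis
          using less_h[OF a(1)] le_h[OF a(1)] s by (metis not_le order.strict_trans1 order.strict_trans2)
      qed
    qed
  qed
qed

section \<open>Lexicographic orderings\<close>

definition lex_less :: "('a \<Rightarrow> nat) \<Rightarrow> 'a set \<Rightarrow> ('a \<Rightarrow> nat) \<Rightarrow> ('a \<Rightarrow> nat) \<Rightarrow> bool" where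
  "lex_less p R u v \<longleftrightarrow> (\<exists>a\<in>R. u a < v a \<and> (\<forall>b\<in>R. p b < p a \<longrightarrow> u b = v b))"

lemma lex_less_irrefl: "\<not> lex_less p R u u"
  by (simp add: lex_less_def)

lemma lex_less_trans:
  assumes "inj_on p R" "lex_less p R u v" "lex_less p R v w"
  shows "lex_less p R u w"
proof -
  obtain a where a: "a \<in> R" "u a < v a" "\<And>b. b \<in> R \<Longrightarrow> p b < p a \<Longrightarrow> u b = v b"
    using assms by (auto simp: lex_less_def)
  obtain c where c: "c \<in> R" "v c < w c" "\<And>b. b \<in> R \<Longrightarrow> p b < p c \<Longrightarrow> v b = w b"
    using assms by (auto simp: lex_less_def)
  consider "p a < p c" | "a = c" | "p c < p a"
    using assms(1) a(1) c(1) by (metis inj_onD linorder_neqE_nat)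
  then show ?thesis
    unfolding lex_less_def
  proof cases
    case 1
    with a c show "\<exists>a\<in>R. u a < w a \<and> (\<forall>b\<in>R. p b < p a \<longrightarrow> u b = w b)"
      by (intro bexI[of _ a]) auto
  next
    case 2
    with a c show "\<exists>a\<in>R. u a < w a \<and> (\<forall>b\<in>R. p b < p a \<longrightarrow> u b = w b)"
      by (intro bexI[of _ a]) auto
  next
    case 3
    with a c show "\<exists>a\<in>R. u a < w a \<and> (\<forall>b\<in>R. p b < p a \<longrightarrow> u b = w b)"
      by (intro bexI[of _ c]) auto
  qed
qed

lemma lex_less_total:
  assumes "inj_on p R" "\<exists>a\<in>R. u a \<noteq> v a"
  shows "lex_less p R u v \<or> lex_less p R v u"
proof -
  obtain a where a: "a \<in> R" "u a \<noteq> v a"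
    "\<And>b. b \<in> R \<Longrightarrow> u b \<noteq> v b \<Longrightarrow> p a \<le> p b"
    using assms(2) ex_has_least_nat[of "\<lambda>a. a \<in> R \<and> u a \<noteq> v a" _ p] by blast
  then show ?thesis
    unfolding lex_less_def by (metis linorder_neqE_nat not_le)
qed

lemma well_order_on_lex:
  fixes u :: "'x \<Rightarrow> 'a \<Rightarrow> nat"
  assumes "finite H" "inj_on p R"
    and sep: "\<And>x y. x \<in> H \<Longrightarrow> y \<in> H \<Longrightarrow> (\<And>a. a \<in> R \<Longrightarrow> u x a = u y a) \<Longrightarrow> x = y"
  shows "well_order_on H {(x, y). x \<in> H \<and> y \<in> H \<and> (x = y \<or> lex_less p R (u x) (u y))}"
    (is "well_order_on H ?r")
proof -
  have "?r \<subseteq> H \<times> H" by auto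
  then have "finite ?r" using assms(1) by (meson finite_SigmaI finite_subset)
  moreover have "linear_order_on H ?r"
    unfolding order_on_defs
  proof (intro conjI)
    show "refl_on H ?r" by (auto simp: refl_on_def)
    show "trans ?r" by (rule transI) (use lex_less_trans[OF assms(2)] in blast)
    show "antisym ?r"
      by (rule antisymI) (use lex_less_trans[OF assms(2)] lex_less_irrefl in blast)
    show "total_on H ?r"
    proof (rule total_onI)
      fix x y assume xy: "x \<in> H" "y \<in> H" "x \<noteq> y"
      then have "\<exists>a\<in>R. u x a \<noteq> u y a" using sep by blast
      then show "(x, y) \<in> ?r \<or> (y, x) \<in> ?r"
        using lex_less_total[OF assms(2)] xy by blast
    qed
  qed fact
  ultimately show ?thesis using linear_order_on_well_order_on by blast
qed

section \<open>The category of ordered injections\<close>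

text \<open>
  Any choice of a linear order on each finite set would do; the countability enumeration gives one
  as a rank function. The orders on different sets need not be compatible.
\<close>

abbreviation pos :: "'a set \<Rightarrow> 'a \<Rightarrow> nat" where
  "pos \<equiv> to_nat_on"

lemma inj_on_pos: "finite R \<Longrightarrow> inj_on (pos R) R"
  by (simp add: countable_finite inj_on_to_nat_on)

definition OI ::
    "('g, 'b) monoid_scheme \<Rightarrow> ('a set, ('a \<Rightarrow> 'a) \<times> ('a \<Rightarrow> 'g)) category" where
  "OI G = \<lparr>Obj = {R. finite R},
     Hom = (\<lambda>R S. {(f, \<lambda>x\<in>R. \<one>\<^bsub>G\<^esub>) | f. f \<in> R \<rightarrow>\<^sub>E S \<and> increasing (pos R) (pos S) R f}),
     Id = (\<lambda>R. (\<lambda>x\<in>R. x, \<lambda>x\<in>R. \<one>\<^bsub>G\<^esub>)),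
     Comp = (\<lambda>R S T. G_map_comp G R)\<rparr>"

lemma Obj_OI: "R \<in> Obj (OI G) \<longleftrightarrow> finite R"
  by (simp add: OI_def)

lemma Hom_OI:
  "m \<in> Hom (OI G) R S \<longleftrightarrow>
     fst m \<in> R \<rightarrow>\<^sub>E S \<and> increasing (pos R) (pos S) R (fst m) \<and> snd m = (\<lambda>x\<in>R. \<one>\<^bsub>G\<^esub>)"
  by (cases m) (auto simp: OI_def)

context group
begin

lemma Comp_OI:
  assumes "f \<in> R \<rightarrow>\<^sub>E S"
  shows "Comp (OI G) R S T (g, \<lambda>x\<in>S. \<one>) (f, \<lambda>x\<in>R. \<one>) = (\<lambda>x\<in>R. g (f x), \<lambda>x\<in>R. \<one>)"
  using assms by (auto simp: OI_def G_map_comp_def fun_eq_iff PiE_iff)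

lemma category_OI: "category (OI G)"
proof
  fix R S T :: "'c set" and m n
  assume objs: "R \<in> Obj (OI G)" "S \<in> Obj (OI G)" "T \<in> Obj (OI G)"
    and "m \<in> Hom (OI G) R S" "n \<in> Hom (OI G) S T"
  then show "Comp (OI G) R S T n m \<in> Hom (OI G) R T"
    by (cases m; cases n) (auto simp: Hom_OI Comp_OI increasing_def PiE_iff)
next
  fix R :: "'c set" assume "R \<in> Obj (OI G)"
  have "Id (OI G) R = (\<lambda>x\<in>R. x, \<lambda>x\<in>R. \<one>)" by (simp add: OI_def)
  then show "Id (OI G) R \<in> Hom (OI G) R R" by (auto simp: Hom_OI increasing_def)
qed (auto simp: OI_def G_map_comp_def PiE_iff extensional_def fun_eq_iff restrict_def)

lemma Hom_OI_subset_FI: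
  assumes "finite R"
  shows "Hom (OI G) R S \<subseteq> Hom (FI G) R S"
  using increasing_imp_inj_on[OF _ inj_on_pos[OF assms]]
  by (auto simp: OI_def FI_def G_maps_def)

lemma functor_OI_FI: "functor_between (OI G) (FI G) (\<lambda>R. R) (\<lambda>R S m. m)"
proof (intro functor_between.intro functor_between_axioms.intro)
  show "category (OI G)" by (rule category_OI)
  show "category (FI G)" by (rule category_FI) unfold_locales
qed (use Hom_OI_subset_FI in \<open>auto simp: Obj_OI\<close>, auto simp: OI_def FI_def)

lemma essentially_surjective_OI_FI: "essentially_surjective (OI G) (FI G) (\<lambda>R. R)"
  unfolding essentially_surjective_def
proof
  interpret FI: category "FI G" by (rule category_FI) unfold_locales
  fix R :: "'c set" assume R: "R \<in> Obj (FI G)"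
  then have "isomorphic (FI G) R R"
    unfolding isomorphic_def using FI.Id_in_Hom FI.Id_left by blast
  moreover have "R \<in> Obj (OI G)" using R by (simp add: OI_def FI_def)
  ultimately show "\<exists>S\<in>Obj (OI G). isomorphic (FI G) S R" by blast
qed

lemma finite_Hom_FI:
  assumes "finite (carrier G)" "finite R" "finite S"
  shows "finite (Hom (FI G) R S)"
proof (rule finite_subset)
  show "Hom (FI G) R S \<subseteq> (R \<rightarrow>\<^sub>E S) \<times> (R \<rightarrow>\<^sub>E carrier G)"
    by (auto simp: FI_def G_maps_def)
  show "finite ((R \<rightarrow>\<^sub>E S) \<times> (R \<rightarrow>\<^sub>E carrier G))"
    using assms by (intro finite_cartesian_product finite_PiE) auto
qed

text \<open>
  All labels can be moved to the automorphism because the label of a composite is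
  \<open>\<sigma> (f x) \<otimes> \<rho> x\<close>, and the increasing factor has \<open>\<sigma> = \<one>\<close>.
\<close>

lemma FI_map_factors_OI:
  assumes "finite R" "finite S" and k: "k \<in> Hom (FI G) R S"
  obtains a m where "a \<in> Hom (FI G) R R" "m \<in> Hom (OI G) R S" "k = Comp (FI G) R R S m a"
proof -
  obtain f \<rho> where k_eq: "k = (f, \<rho>)" and f: "f \<in> R \<rightarrow>\<^sub>E S" "inj_on f R"
    and \<rho>: "\<rho> \<in> R \<rightarrow>\<^sub>E carrier G"
    using k by (auto simp: FI_def G_maps_def)
  obtain \<sigma> g where \<sigma>: "bij_betw \<sigma> R R" and g: "g ` R \<subseteq> S" "increasing (pos R) (pos S) R g"
    and fac: "\<And>x. x \<in> R \<Longrightarrow> g (\<sigma> x) = f x"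
    using injection_factors_increasing[OF assms(1,2) inj_on_pos inj_on_pos, of f] assms f
    by blast
  show ?thesis
  proof
    show "(restrict \<sigma> R, \<rho>) \<in> Hom (FI G) R R"
      using \<sigma> \<rho> by (auto simp: FI_def G_maps_def bij_betw_def)
    show "(restrict g R, \<lambda>x\<in>R. \<one>) \<in> Hom (OI G) R S"
      using g by (auto simp: Hom_OI increasing_def)
    show "k = Comp (FI G) R R S (restrict g R, \<lambda>x\<in>R. \<one>) (restrict \<sigma> R, \<rho>)"
      using \<sigma> f \<rho> fac
      by (auto simp: k_eq FI_def G_map_comp_def fun_eq_iff PiE_iff extensional_def bij_betw_def)
  qed
qed

text \<open>
  The finitely many test objects are all \<open>R\<close> itself, and the test maps are the automorphisms
  of \<open>R\<close>.
\<close>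

lemma property_F_OI_FI:
  assumes "finite (carrier G)"
  shows "property_F (OI G) (FI G) (\<lambda>R. R) (\<lambda>R S m. m)"
  unfolding property_F_def
proof
  fix R :: "'c set" assume "R \<in> Obj (FI G)"
  then have R: "finite R" by (simp add: FI_def)
  obtain n :: nat and a where a: "Hom (FI G) R R = a ` {i. i < n}"
    using finite_Hom_FI[OF assms R R] finite_imp_nat_seg_image_inj_on by blast
  show "\<exists>(n::nat) y f. (\<forall>i<n. y i \<in> Obj (OI G) \<and> f i \<in> Hom (FI G) R (y i)) \<and>
        (\<forall>S\<in>Obj (OI G). \<forall>k\<in>Hom (FI G) R S. \<exists>i<n. \<exists>g\<in>Hom (OI G) (y i) S.
           k = Comp (FI G) R (y i) S g (f i))"
  proof (rule exI[of _ n], rule exI[of _ "\<lambda>_. R"], rule exI[of _ a], intro conjI ballI allI impI)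
    show "R \<in> Obj (OI G)" using R by (simp add: Obj_OI)
    show "a i \<in> Hom (FI G) R R" if "i < n" for i using a that by blast
    fix S k assume "S \<in> Obj (OI G)" "k \<in> Hom (FI G) R S"
    then obtain b m where "b \<in> Hom (FI G) R R" "m \<in> Hom (OI G) R S" "k = Comp (FI G) R R S m b"
      using FI_map_factors_OI R by (metis Obj_OI)
    moreover from this obtain i where "i < n" "b = a i" using a by blast
    ultimately show "\<exists>i<n. \<exists>g\<in>Hom (OI G) R S. k = Comp (FI G) R R S g (a i)"
      by blast
  qed
qed

text \<open>
  Two maps that first differ at \<open>a\<close> still first differ at \<open>a\<close>, and in the same direction, after
  composition with an increasing map.
\<close>

lemma orderable_OI:
  assumes R: "R \<in> Obj (OI G)"
  shows "orderable (OI G) R"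
proof -
  let ?u = "\<lambda>S (m :: ('c \<Rightarrow> 'c) \<times> ('c \<Rightarrow> 'a)) a. pos S (fst m a)"
  let ?r = "\<lambda>S. {(m, n). m \<in> Hom (OI G) R S \<and> n \<in> Hom (OI G) R S \<and>
    (m = n \<or> lex_less (pos R) R (?u S m) (?u S n))}"
  have R: "finite R" using R by (simp add: Obj_OI)
  interpret OI: category "OI G" by (rule category_OI)
  have "is_ordering (OI G) R ?r"
    unfolding is_ordering_def
  proof (intro conjI ballI impI)
    fix S :: "'c set" assume "S \<in> Obj (OI G)"
    then have S: "finite S" by (simp add: Obj_OI)
    show "well_order_on (Hom (OI G) R S) (?r S)"
    proof (rule well_order_on_lex[OF _ inj_on_pos[OF R]])
      show "finite (Hom (OI G) R S)"
      proof (rule finite_subset)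
        show "Hom (OI G) R S \<subseteq> (R \<rightarrow>\<^sub>E S) \<times> {\<lambda>x\<in>R. \<one>}" by (auto simp: Hom_OI)
        show "finite ((R \<rightarrow>\<^sub>E S) \<times> {\<lambda>x\<in>R. \<one>})" using R S by (simp add: finite_PiE)
      qed
      fix m n assume mn: "m \<in> Hom (OI G) R S" "n \<in> Hom (OI G) R S"
        and eq: "\<And>a. a \<in> R \<Longrightarrow> ?u S m a = ?u S n a"
      have "fst m a = fst n a" if "a \<in> R" for a
        using eq[OF that] mn that inj_onD[OF inj_on_pos[OF S]] by (auto simp: Hom_OI PiE_iff)
      then have "fst m = fst n" using mn by (auto simp: Hom_OI intro: PiE_ext)
      then show "m = n" using mn by (simp add: Hom_OI prod_eq_iff)
    qed
  next
    fix S T :: "'c set" and h m n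
    assume ST: "S \<in> Obj (OI G)" "T \<in> Obj (OI G)" and h: "h \<in> Hom (OI G) S T"
      and mn: "m \<in> Hom (OI G) R S" "n \<in> Hom (OI G) R S" "(m, n) \<in> ?r S \<and> m \<noteq> n"
    have val: "fst (Comp (OI G) R S T h l) a = fst h (fst l a)" if "a \<in> R" for l a
      using that by (simp add: OI_def G_map_comp_def split: prod.split)
    obtain a where a: "a \<in> R" "pos S (fst m a) < pos S (fst n a)"
      "\<And>b. b \<in> R \<Longrightarrow> pos R b < pos R a \<Longrightarrow> pos S (fst m b) = pos S (fst n b)"
      using mn unfolding lex_less_def by blast
    have in_S: "fst m b \<in> S" "fst n b \<in> S" if "b \<in> R" for b
      using that mn by (auto simp: Hom_OI)
    have "finite S" using ST by (simp add: Obj_OI)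
    then have "fst m b = fst n b" if "b \<in> R" "pos R b < pos R a" for b
      using a(3)[OF that] in_S[OF that(1)] inj_onD[OF inj_on_pos] by metis
    moreover have "pos T (fst h (fst m a)) < pos T (fst h (fst n a))"
      using h in_S[OF a(1)] a(2) by (simp add: Hom_OI increasing_def)
    ultimately have less: "lex_less (pos R) R (?u T (Comp (OI G) R S T h m)) (?u T (Comp (OI G) R S T h n))"
      unfolding lex_less_def using a(1) by (intro bexI[of _ a]) (simp_all add: val)
    then show "Comp (OI G) R S T h m \<noteq> Comp (OI G) R S T h n"
      using lex_less_irrefl by metis
    show "(Comp (OI G) R S T h m, Comp (OI G) R S T h n) \<in> ?r T"
      using less OI.Comp_in_Hom ST h mn R Obj_OI by blast
  qed
  then show ?thesis unfolding orderable_def by blast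
qed

text \<open>
  Dickson's lemma is applied to the vectors of fibre sizes, which are indexed by pairs of subsets
  of \<open>R\<close> for every target; the comparing map then comes from \<open>increasing_extension\<close>.
\<close>

lemma noetherian_OI:
  assumes R: "R \<in> Obj (OI G)"
  shows "noetherian_on (poset_carrier (OI G) R) (poset_le (OI G) R)"
proof (rule noetherian_quotientI[OF category_OI R])
  fix s :: "nat \<Rightarrow> 'c set \<times> ('c \<Rightarrow> 'c) \<times> ('c \<Rightarrow> 'a)"
  assume s: "\<And>n. s n \<in> from_object (OI G) R"
  have R: "finite R" using R by (simp add: Obj_OI)
  define S where "S n = fst (s n)" for n
  define f where "f n = fst (snd (s n))" for n
  have S: "finite (S n)" and f: "f n \<in> R \<rightarrow>\<^sub>E S n"
    and s_eq: "s n = (S n, f n, \<lambda>x\<in>R. \<one>)" for n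
    using s[of n] by (auto simp: S_def f_def from_object_def Obj_OI Hom_OI prod_eq_iff)
  obtain i j where ij: "i < j" "\<And>k. k \<in> Pow R \<times> Pow R \<Longrightarrow>
      card {t \<in> S i. cut_at (pos (S i)) R (f i) t = k} \<le> card {t \<in> S j. cut_at (pos (S j)) R (f j) t = k}"
    using dickson[of "Pow R \<times> Pow R" "\<lambda>n k. card {t \<in> S n. cut_at (pos (S n)) R (f n) t = k}"] R
    by blast
  obtain h where h: "h ` S i \<subseteq> S j" "increasing (pos (S i)) (pos (S j)) (S i) h"
    "\<And>a. a \<in> R \<Longrightarrow> h (f i a) = f j a"
    using increasing_extension[OF S S inj_on_pos[OF S] inj_on_pos[OF S] _ _ ij(2)] f
    by (metis PiE_mem image_subsetI)
  let ?h = "(restrict h (S i), \<lambda>x\<in>S i. \<one>)"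
  have "?h \<in> Hom (OI G) (S i) (S j)"
    using h by (auto simp: Hom_OI increasing_def)
  moreover have "snd (s j) = Comp (OI G) R (S i) (S j) ?h (snd (s i))"
    using h(3) f[of i] f[of j] by (auto simp: s_eq Comp_OI fun_eq_iff PiE_iff extensional_def)
  ultimately have "(s i, s j) \<in> from_le (OI G) R"
    using s[of i] s[of j] unfolding from_le_def by (auto simp: s_eq)
  with ij(1) show "\<exists>i j. i < j \<and> (s i, s j) \<in> from_le (OI G) R" by blast
qed

lemma groebner_OI: "groebner (OI G)"
  unfolding groebner_def using category_OI orderable_OI noetherian_OI by blast

end

theorem theorem1p2p3:
  fixes G :: "('g, 'b) monoid_scheme"
  assumes "group G" and "finite (carrier G)"
  shows "quasi_groebner (FI G :: ('a::infinite set, ('a \<Rightarrow> 'a) \<times> ('a \<Rightarrow> 'g)) category)"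
proof -
  interpret group G by fact
  show ?thesis
    by (rule quasi_groebnerI[OF groebner_OI functor_OI_FI essentially_surjective_OI_FI
          property_F_OI_FI[OF assms(2)]])
qed

end
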